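(* Let $n \geq 2$ be an integer, $N := n-\frac{1}{24}$, and let $j$ be a positive integer with $j \leq \frac{\sqrt{N}}{4}$. Then \[ \frac{p(n) - 2p(n-j) + p(n-2j)}{p(n)} > 0. \]
   Context: $p(m)$ denotes the number of partitions of the nonnegative integer $m$ ($p(0)=1$). *)

theory Defs
  imports Complex_Main "HOL-Library.Multiset"
begin

definition partitions :: "nat \<Rightarrow> nat multiset set" where
  "partitions m = {M. 0 \<notin># M \<and> \<Sum>\<^sub># M = m}"

definition p :: "nat \<Rightarrow> nat" where
  "p m = card (partitions m)"

text \<open>Finiteness ensures that the cardinality above is a genuine count.\<close>

lemma finite_partitions: "finite (partitions m)"
proof (rule finite_subset)
  show "partitions m \<subseteq> mset ` {xs. set xs \<subseteq> {..m} \<and> length xs \<le> m}"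
  proof
    fix M assume "M \<in> partitions m"
    then have M: "0 \<notin># M" "\<Sum>\<^sub># M = m" by (auto simp: partitions_def)
    obtain xs where xs: "M = mset xs" using ex_mset[of M] by auto
    have "size A \<le> \<Sum>\<^sub># A" if "0 \<notin># A" for A :: "nat multiset"
      using that by (induction A) auto
    from this[OF M(1)] have "length xs \<le> m" using M(2) xs by simp
    moreover have "set xs \<subseteq> {..m}"
    proof
      fix x assume "x \<in> set xs"
      then have "x \<le> sum_list xs" by (simp add: member_le_sum_list)
      then show "x \<in> {..m}" using M(2) xs by (simp add: sum_mset_sum_list)
    qed
    ultimately show "M \<in> mset ` {xs. set xs \<subseteq> {..m} \<and> length xs \<le> m}"
      using xs by auto
  qed
  show "finite (mset ` {xs. set xs \<subseteq> {..m} \<and> length xs \<le> m})"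
    by (intro finite_imageI finite_lists_length_le finite_atMost)
qed

lemma p_0: "p 0 = 1"
proof -
  have "partitions 0 = {{#}}"
  proof (intro equalityI subsetI)
    fix M assume "M \<in> partitions 0"
    then have "0 \<notin># M" "\<forall>x \<in># M. x = 0" by (simp_all add: partitions_def)
    then show "M \<in> {{#}}" by (cases M) auto
  qed (simp add: partitions_def)
  then show ?thesis by (simp add: p_def)
qed

end

theory Submission imports Defs begin

text \<open>
  The difference \<open>p n - p (n - j)\<close> counts the partitions of \<open>n\<close> that avoid the part \<open>j\<close>, so the
  second difference is positive iff there are more such partitions of \<open>n\<close> than of \<open>n - j\<close>.
  For \<open>j \<ge> 2\<close>, adding \<open>j\<close> parts equal to \<open>1\<close> is an injection from the latter to the former that
  misses the one-part partition. For \<open>j = 1\<close>, increasing a largest part by \<open>1\<close> is an injection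
  that misses every partition whose largest part is repeated.
\<close>

definition avoiding :: "nat \<Rightarrow> nat \<Rightarrow> nat multiset set" where
  "avoiding j m = {M \<in> partitions m. j \<notin># M}"

lemma finite_avoiding: "finite (avoiding j m)"
  by (simp add: avoiding_def finite_partitions)

text \<open>Removing one copy of \<open>j\<close> is a bijection from the partitions of
  \<open>m\<close> that contain \<open>j\<close> onto all partitions of
  \<open>m - j\<close>.\<close>

lemma p_eq_card_avoiding_plus:
  assumes "0 < j" "j \<le> m"
  shows "p m = card (avoiding j m) + p (m - j)"
proof -
  have "{M \<in> partitions m. j \<in># M} = add_mset j ` partitions (m - j)"
  proof (intro equalityI subsetI)
    fix M assume "M \<in> {M \<in> partitions m. j \<in># M}"
    then obtain K where "M = add_mset j K" "M \<in> partitions m"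
      by (auto dest: multi_member_split)
    then show "M \<in> add_mset j ` partitions (m - j)"
      by (auto simp: partitions_def)
  qed (use assms in \<open>auto simp: partitions_def\<close>)
  then have "card {M \<in> partitions m. j \<in># M} = p (m - j)"
    by (simp add: p_def card_image inj_on_def)
  moreover have "partitions m = avoiding j m \<union> {M \<in> partitions m. j \<in># M}"
    by (auto simp: avoiding_def)
  then have "p m = card (avoiding j m) + card {M \<in> partitions m. j \<in># M}"
    unfolding p_def
    by (subst card_Un_disjoint[symmetric]) (auto simp: avoiding_def finite_partitions)
  ultimately show ?thesis by simp
qed

lemma card_avoiding_less:
  assumes "inj_on f (avoiding j m)" "f ` avoiding j m \<subseteq> avoiding j n"
    and "Q \<in> avoiding j n" "Q \<notin> f ` avoiding j m"
  shows "card (avoiding j m) < card (avoiding j n)"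
proof -
  have "card (f ` avoiding j m) < card (avoiding j n)"
    using assms by (intro psubset_card_mono finite_avoiding) blast
  then show ?thesis using assms(1) by (simp add: card_image)
qed

lemma card_avoiding_add_less:
  assumes "2 \<le> j" "0 < m"
  shows "card (avoiding j m) < card (avoiding j (m + j))"
proof (rule card_avoiding_less[where f = "\<lambda>M. M + replicate_mset j 1" and Q = "{#m + j#}"])
  show "{#m + j#} \<notin> (\<lambda>M. M + replicate_mset j 1) ` avoiding j m"
  proof
    assume "{#m + j#} \<in> (\<lambda>M. M + replicate_mset j 1) ` avoiding j m"
    then obtain M where "{#m + j#} = M + replicate_mset j 1" by blast
    \<comment> \<open>Every image has at least \<open>j \<ge> 2\<close> parts.\<close>
    then have "size {#m + j#} = size (M + replicate_mset j 1)" by (rule arg_cong)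
    then show False using assms by simp
  qed
\<comment> \<open>Since \<open>j \<noteq> 1\<close>, the added ones are allowed parts; since
  \<open>0 < m\<close>, the part \<open>m + j\<close> differs from \<open>j\<close>.\<close>
qed (use assms in \<open>auto simp: avoiding_def partitions_def inj_on_def\<close>)

definition incr_max :: "nat multiset \<Rightarrow> nat multiset" where
  "incr_max M = add_mset (Suc (Max_mset M)) (M - {#Max_mset M#})"

lemma Max_incr_max: "Max_mset (incr_max M) = Suc (Max_mset M)"
  unfolding incr_max_def
  by (rule Max_eqI) (auto dest!: in_diffD intro: le_SucI)

text \<open>The largest part of the image reveals the part that was increased, and the other parts
  are unchanged. The empty multiset must be excluded: with \<open>c\<close> the unspecified value
  \<open>Max_mset {#}\<close>, it has the same image as \<open>{#c#}\<close>.\<close>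

lemma inj_on_incr_max: "inj_on incr_max {M. M \<noteq> {#}}"
proof (rule inj_onI)
  fix M K assume ne: "M \<in> {M. M \<noteq> {#}}" "K \<in> {M. M \<noteq> {#}}" and eq: "incr_max M = incr_max K"
  from eq have "Max_mset M = Max_mset K"
    using Max_incr_max[of M] Max_incr_max[of K] by simp
  moreover from this eq have "M - {#Max_mset M#} = K - {#Max_mset K#}"
    by (simp add: incr_max_def)
  moreover have "Max_mset M \<in># M" "Max_mset K \<in># K" using ne by auto
  ultimately show "M = K" by (metis insert_DiffM)
qed

text \<open>The new part exceeds every part of \<open>M\<close>, so it cannot be repeated. This is
  the invariant that shows a partition to lie outside the image.\<close>

lemma count_Max_incr_max: "count (incr_max M) (Max_mset (incr_max M)) = 1"
proof -
  have "Suc (Max_mset M) \<notin># M"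
    using Max_ge[OF finite_set_mset, of "Suc (Max_mset M)" M] Suc_n_not_le_n by blast
  then have "count M (Suc (Max_mset M)) = 0" by (simp add: not_in_iff)
  then show ?thesis unfolding Max_incr_max by (simp add: incr_max_def)
qed

lemma card_avoiding_1_less:
  assumes "8 \<le> m"
  shows "card (avoiding 1 m) < card (avoiding 1 (Suc m))"
proof -
  \<comment> \<open>Two equal parts \<open>k\<close>, plus a 3 if \<open>Suc m\<close> is odd, will
    form the missed partition. The bound \<open>8 \<le> m\<close> gives \<open>3 \<le> k\<close>, so
    that \<open>k\<close> is its largest part.\<close>
  obtain k R where k: "3 \<le> k" "R = {#} \<or> R = {#3#}" "Suc m = 2 * k + \<Sum>\<^sub># R"
  proof (cases "even m")
    case True
    then show ?thesis using assms that[of "(m - 2) div 2" "{#3#}"] by (auto elim!: evenE)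
  next
    case False
    then show ?thesis using assms that[of "Suc m div 2" "{#}"] by (auto elim!: oddE)
  qed
  define Q where "Q = add_mset k (add_mset k R)"
  have ne: "avoiding 1 m \<subseteq> {M. M \<noteq> {#}}"
    using assms by (auto simp: avoiding_def partitions_def)
  show ?thesis
  proof (rule card_avoiding_less)
    show "inj_on incr_max (avoiding 1 m)"
      using inj_on_incr_max ne by (rule inj_on_subset)
    show "incr_max ` avoiding 1 m \<subseteq> avoiding 1 (Suc m)"
    proof (rule image_subsetI)
      fix M assume M: "M \<in> avoiding 1 m"
      then have "Max_mset M \<in># M" using ne by auto
      then obtain x K where x: "x = Max_mset M" "M = add_mset x K"
        by (blast dest: multi_member_split)
      have "incr_max M = add_mset (Suc x) K"
        unfolding incr_max_def x(1)[symmetric] by (simp add: x(2))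
      \<comment> \<open>The part \<open>x\<close> is positive, so \<open>Suc x\<close> is not the
        forbidden 1.\<close>
      then show "incr_max M \<in> avoiding 1 (Suc m)"
        using M x(2) by (auto simp: avoiding_def partitions_def)
    qed
    show "Q \<in> avoiding 1 (Suc m)"
      using k by (auto simp: Q_def avoiding_def partitions_def)
    have "Max_mset Q = k"
      using k by (intro Max_eqI) (auto simp: Q_def)
    then have "count Q (Max_mset Q) \<noteq> 1" by (simp add: Q_def)
    then show "Q \<notin> incr_max ` avoiding 1 m"
      using count_Max_incr_max by auto
  qed
qed

theorem theorem2p3:
  fixes n j :: nat and N :: real
  assumes "n \<ge> 2"
    and "N = real n - 1 / 24"
    and "j > 0"
    and "real j \<le> sqrt N / 4"
  shows "(real (p n) - 2 * real (p (n - j)) + real (p (n - 2 * j))) / real (p n) > 0"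
proof -
  have "4 * real j \<le> sqrt N" using assms(4) by simp
  then have "(4 * real j)\<^sup>2 \<le> (sqrt N)\<^sup>2" by (rule power_mono) simp
  also have "\<dots> = N" using assms(1,2) by simp
  also have "\<dots> < real n" using assms(2) by simp
  finally have "real (16 * (j * j)) < real n" by (simp add: power2_eq_square)
  then have n: "16 * (j * j) < n" by (simp only: of_nat_less_iff)
  moreover have "j * 1 \<le> j * j" using assms(3) by (intro mult_le_mono) auto
  \<comment> \<open>This linear bound is all that the rest uses: it gives
    \<open>8 \<le> n - 1\<close> for \<open>j = 1\<close>, and \<open>0 < n - j\<close> and
    \<open>2 * j \<le> n\<close> in general.\<close>
  ultimately have jn: "16 * j < n" by linarith
  have "card (avoiding j (n - j)) < card (avoiding j n)"
  proof (cases "j = 1")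
    case True
    then show ?thesis using card_avoiding_1_less[of "n - 1"] jn by simp
  next
    case False
    then show ?thesis using card_avoiding_add_less[of j "n - j"] jn assms(3) by simp
  qed
  moreover have "p n = card (avoiding j n) + p (n - j)"
    using assms(3) jn by (intro p_eq_card_avoiding_plus) auto
  moreover have "p (n - j) = card (avoiding j (n - j)) + p (n - 2 * j)"
    using assms(3) jn p_eq_card_avoiding_plus[of j "n - j"] by (simp add: mult_2)
  \<comment> \<open>Subtracting the two recurrences leaves the difference of the two cardinalities;
    the strict inequality also makes the larger one, hence \<open>p n\<close>, positive.\<close>
  ultimately have "real (p n) - 2 * real (p (n - j)) + real (p (n - 2 * j)) > 0" "p n > 0"
    by linarith+
  then show ?thesis by simp
qed

end
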